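(* For every positive integer $i$ there exists a virtual knot $K_i$ that is homotopic (as a virtual knot) to the unknot and satisfies $\mathrm{vb}(K_i)=1$ and $\mathrm{vu}(K_i)=i$.
   Context: **Gauss diagrams.** A Gauss diagram is an oriented circle together with a finite (possibly empty) set of chords with pairwise distinct endpoints on the circle. Each chord is oriented (an arrow from its tail to its head) and carries a sign $+1$ or $-1$. Gauss diagrams are considered up to orientation-preserving homeomorphism of the circle preserving the chords with their orientations and signs. For the Gauss diagram of an oriented knot diagram, the chords join the two preimages of each crossing, are oriented from the overpass to the underpass, and carry the sign of the crossing. Arbitrary Gauss diagrams are allowed; they need not come from a knot diagram in the plane. **Reidemeister moves on Gauss diagrams** (each move and its inverse). Two or more endpoints are "adjacent" if they lie on an arc of the circle containing no other chord endpoints. (R1) Add or delete a chord of any orientation and sign whose two endpoints are adjacent. (R2) Add or delete two chords of opposite signs whose tails are adjacent to each other and whose heads are adjacent to each other (the relative order of the two chords on the tail arc and on the head arc is arbitrary). (R3) The Gauss diagram version of the planar third Reidemeister move. Suppose there are three disjoint arcs $T,M,B$ of the circle (top, middle, bottom strands) and three chords $c_{TM},c_{TB},c_{MB}$, where $c_{XY}$ has tail on $X$ and head on $Y$, such that these arcs contain no other chord endpoints. Simultaneously exchange the order of the two endpoints on each of the three arcs, leaving orientations and signs of chords unchanged. The move is allowed exactly for the configurations that arise from three oriented strands in the plane. Explicitly: let $\varepsilon_{XY}$ be the sign of $c_{XY}$; let $o_T=+1$ if the endpoint of $c_{TM}$ precedes that of $c_{TB}$ on $T$ and $-1$ otherwise;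 let $o_M=+1$ if the endpoint of $c_{TM}$ precedes that of $c_{MB}$ on $M$ and $-1$ otherwise; let $o_B=+1$ if the endpoint of $c_{TB}$ precedes that of $c_{MB}$ on $B$ and $-1$ otherwise. The move is allowed if for some $P\in\{+1,-1\}$ one has $o_M=P\varepsilon_{TM}$, $o_B=P\varepsilon_{TB}$, $o_T=P\varepsilon_{TM}\varepsilon_{TB}\varepsilon_{MB}$. **Virtual knots.** An isotopy between two Gauss diagrams is a finite sequence of the Reidemeister moves (R1), (R2), (R3) on Gauss diagrams and their inverses. A virtual knot is an equivalence class of Gauss diagrams under isotopy; a diagram in the class is said to realize the virtual knot. The unknot is the class of the trivial Gauss diagram with no chords. **Homotopy.** A flip move on a chord simultaneously reverses the direction of the chord and changes its sign. A (generic) homotopy between two Gauss diagrams is a finite sequence of Reidemeister moves and flip moves. Two virtual knots are homotopic if diagrams realizing them are related by a homotopy. **Virtual bridge number.** The number of bridges of a Gauss diagram is the number of arcs of the circle between two consecutive arrow heads that contain at least one arrow tail (if there is exactly one chord, the complement of its head counts as such an arc, so there is one bridge; the trivial diagram has $0$ bridges). The virtual bridge number $\mathrm{vb}(K)$ is the minimum number of bridges over all Gauss diagrams realizing the virtual knot $K$. **Virtual unknotting number.** If $K$ is a virtual knot homotopic to the unknot, $\mathrm{vu}(K)$ is the minimal number of flip moves in a homotopy changing $K$ to the unknot. *)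

theory Defs
  imports Main
begin

section \<open>Gauss diagrams\<close>

text \<open>
  A Gauss diagram is encoded by the word of chord endpoints read once around the oriented circle
  from an arbitrary base point. A chord is named by a label, and each of its two endpoints
  also carries the sign of the chord.
\<close>

datatype 'c endpoint =
    is_tail: Tail (chord: 'c) (sign: int)
  | is_head: Head (chord: 'c) (sign: int)

type_synonym gauss_word = "nat endpoint list"

definition chords :: "gauss_word \<Rightarrow> nat set" where
  "chords D = chord ` set D"

definition gauss_diagram :: "gauss_word \<Rightarrow> bool" where
  "gauss_diagram D \<longleftrightarrow>
     distinct D \<and>
     (\<forall>c s. Tail c s \<in> set D \<longleftrightarrow> Head c s \<in> set D) \<and>
     (\<forall>e\<in>set D. sign e \<in> {1, -1}) \<and>
     (\<forall>e\<in>set D. \<forall>f\<in>set D. chord e = chord f \<longrightarrow> sign e = sign f)"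

text \<open>
  Orientation-preserving homeomorphism of the circle respecting the chords: on words this is
  a change of base point together with a renaming of the chords.
\<close>

definition homeomorphic :: "gauss_word \<Rightarrow> gauss_word \<Rightarrow> bool" where
  "homeomorphic D E \<longleftrightarrow>
     gauss_diagram D \<and> gauss_diagram E \<and>
     (\<exists>f n. inj_on f (chords D) \<and> E = rotate n (map (map_endpoint f) D))"


section \<open>Reidemeister moves\<close>

text \<open>
  An arc carrying two endpoints: \<open>x\<close> precedes \<open>y\<close> if the sign \<open>p\<close> is \<open>1\<close>,
  and \<open>y\<close> precedes \<open>x\<close> if it is \<open>-1\<close>.
\<close>

definition arc :: "int \<Rightarrow> 'a \<Rightarrow> 'a \<Rightarrow> 'a list" where
  "arc p x y = (if p = 1 then [x, y] else [y, x])"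

text \<open>
  The moves are given with the base point just before one of the arcs involved; all other
  positions are obtained by composing with \<open>homeomorphic\<close>. The two rules for the
  third move correspond to the two cyclic orders of the strands \<open>T\<close>, \<open>M\<close>, \<open>B\<close>.
  Inverse moves are supplied by the closure in \<open>isotopic\<close> below.
\<close>

definition R3_allowed :: "int \<Rightarrow> int \<Rightarrow> int \<Rightarrow> int \<Rightarrow> int \<Rightarrow> int \<Rightarrow> bool" where
  "R3_allowed oT oM oB eTM eTB eMB \<longleftrightarrow>
     (\<exists>P\<in>{1, -1}. oM = P * eTM \<and> oB = P * eTB \<and> oT = P * eTM * eTB * eMB)"

inductive reidemeister :: "gauss_word \<Rightarrow> gauss_word \<Rightarrow> bool" where
  R1: "reidemeister (arc p (Tail c s) (Head c s) @ u) u"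
    if "gauss_diagram (arc p (Tail c s) (Head c s) @ u)" and "gauss_diagram u"
| R2: "reidemeister
         (arc p (Tail a s) (Tail b (-s)) @ u @ arc q (Head a s) (Head b (-s)) @ v)
         (u @ v)"
    if "gauss_diagram
          (arc p (Tail a s) (Tail b (-s)) @ u @ arc q (Head a s) (Head b (-s)) @ v)"
      and "gauss_diagram (u @ v)"
| R3_TMB: "reidemeister (T oT @ u @ M oM @ v @ B oB @ w)
                        (T (-oT) @ u @ M (-oM) @ v @ B (-oB) @ w)"
    if "T = (\<lambda>p. arc p (Tail tm eTM) (Tail tb eTB))"
      and "M = (\<lambda>p. arc p (Head tm eTM) (Tail mb eMB))"
      and "B = (\<lambda>p. arc p (Head tb eTB) (Head mb eMB))"
      and "R3_allowed oT oM oB eTM eTB eMB"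
      and "gauss_diagram (T oT @ u @ M oM @ v @ B oB @ w)"
      and "gauss_diagram (T (-oT) @ u @ M (-oM) @ v @ B (-oB) @ w)"
| R3_TBM: "reidemeister (T oT @ u @ B oB @ v @ M oM @ w)
                        (T (-oT) @ u @ B (-oB) @ v @ M (-oM) @ w)"
    if "T = (\<lambda>p. arc p (Tail tm eTM) (Tail tb eTB))"
      and "M = (\<lambda>p. arc p (Head tm eTM) (Tail mb eMB))"
      and "B = (\<lambda>p. arc p (Head tb eTB) (Head mb eMB))"
      and "R3_allowed oT oM oB eTM eTB eMB"
      and "gauss_diagram (T oT @ u @ B oB @ v @ M oM @ w)"
      and "gauss_diagram (T (-oT) @ u @ B (-oB) @ v @ M (-oM) @ w)"


section \<open>Virtual knots\<close>

definition isotopic :: "gauss_word \<Rightarrow> gauss_word \<Rightarrow> bool" where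
  "isotopic = equivclp (\<lambda>D E. homeomorphic D E \<or> reidemeister D E)"

definition isotopy_rel :: "(gauss_word \<times> gauss_word) set" where
  "isotopy_rel = {(D, E). gauss_diagram D \<and> gauss_diagram E \<and> isotopic D E}"

definition virtual_knots :: "gauss_word set set" where
  "virtual_knots = Collect gauss_diagram // isotopy_rel"

definition unknot :: "gauss_word set" where
  "unknot = isotopy_rel `` {[]}"

lemma equiv_isotopy_rel: "equiv (Collect gauss_diagram) isotopy_rel"
  unfolding isotopy_rel_def isotopic_def
  by (auto intro!: equivI refl_onI symI transI intro: equivclp_sym equivclp_trans)

lemma gauss_diagram_Nil: "gauss_diagram []"
  by (simp add: gauss_diagram_def)

lemma unknot_in_virtual_knots: "unknot \<in> virtual_knots"
  unfolding unknot_def virtual_knots_def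
  by (rule quotientI) (simp add: gauss_diagram_Nil)


section \<open>Homotopy\<close>

fun flip_endpoint :: "nat \<Rightarrow> nat endpoint \<Rightarrow> nat endpoint" where
  "flip_endpoint c (Tail d s) = (if d = c then Head d (-s) else Tail d s)"
| "flip_endpoint c (Head d s) = (if d = c then Tail d (-s) else Head d s)"

definition flip :: "nat \<Rightarrow> gauss_word \<Rightarrow> gauss_word" where
  "flip c D = map (flip_endpoint c) D"

text \<open>\<open>homotopy n D E\<close>: some homotopy from \<open>D\<close> to \<open>E\<close> uses exactly \<open>n\<close> flip moves.\<close>

inductive homotopy :: "nat \<Rightarrow> gauss_word \<Rightarrow> gauss_word \<Rightarrow> bool" where
  isotopy: "isotopic D E \<Longrightarrow> homotopy 0 D E"
| flip: "homotopy n D E \<Longrightarrow> c \<in> chords E \<Longrightarrow> isotopic (flip c E) F \<Longrightarrow> homotopy (Suc n) D F"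

definition homotopic :: "gauss_word set \<Rightarrow> gauss_word set \<Rightarrow> bool" where
  "homotopic K L \<longleftrightarrow> (\<exists>D\<in>K. \<exists>E\<in>L. \<exists>n. homotopy n D E)"


section \<open>Virtual bridge number and virtual unknotting number\<close>

text \<open>
  The endpoints met after position \<open>i\<close> (cyclically) before the next arrow head. If \<open>D ! i\<close>
  is the only head, this runs all the way around the circle back to it.
\<close>

definition arc_after :: "gauss_word \<Rightarrow> nat \<Rightarrow> nat endpoint list" where
  "arc_after D i = takeWhile (\<lambda>e. \<not> is_head e) (rotate (Suc i) D)"

text \<open>An arc between consecutive heads is indexed by the head at which it starts.\<close>

definition bridges :: "gauss_word \<Rightarrow> nat" where
  "bridges D =
     card {i. i < length D \<and> is_head (D ! i) \<and> (\<exists>e\<in>set (arc_after D i). is_tail e)}"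

definition vb :: "gauss_word set \<Rightarrow> nat" where
  "vb K = (LEAST n. \<exists>D\<in>K. bridges D = n)"

text \<open>Only meaningful when \<open>K\<close> is homotopic to the unknot.\<close>

definition vu :: "gauss_word set \<Rightarrow> nat" where
  "vu K = (LEAST n. \<exists>D\<in>K. \<exists>E\<in>unknot. homotopy n D E)"

end

theory Submission
  imports Defs
begin

text \<open>
  Call a chord odd if an odd number of chord endpoints lies strictly between its tail and its head;
  since a Gauss diagram has an even number of endpoints, it does not matter which of the two arcs
  is counted. The sum of the signs of the odd chords is Kauffman's odd writhe. It is an isotopy
  invariant: the first two moves insert or delete adjacent pairs of endpoints, so they do not change
  the parity of the remaining chords; the chord of a first move is even, and the two chords of a
  second move have equal parity and opposite signs; a third move displaces both ends of each of
  its three chords by one place. A flip move does not touch parities and negates the sign of a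
  single chord, so it changes the odd writhe by at most two. Hence a diagram with odd writhe
  \<open>2 i\<close> needs at least \<open>i\<close> flip moves to reach the unknot (\<open>homotopy_odd_writhe\<close>).

  The bound is attained by the diagram with \<open>2 i\<close> positive chords whose tails come first and
  whose heads follow in the same order. Every chord then crosses every other one and is odd, so the
  odd writhe is \<open>2 i\<close>, and all tails lie in one arc between heads, so there is one bridge.
  After the first \<open>i\<close> chords are flipped, the tails read around the circle consist of \<open>i\<close>
  positive ones followed by \<open>i\<close> negative ones, and the heads come in the same order. The
  innermost positive and negative chord cancel in a second move, and this repeats until no chord is
  left (\<open>homotopy_example_Nil\<close>).

  Finally, the only diagram without bridges is the empty one (\<open>bridges_eq_0\<close>), and its odd
  writhe is zero, so no diagram of this virtual knot has fewer bridges.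
\<close>

section \<open>Odd chords\<close>

text \<open>
  The entries at the even (\<open>True\<close>) or odd (\<open>False\<close>) positions of a word, counted from
  \<open>0\<close>. A chord is odd exactly when both its ends fall into the same class. Formulating parity
  by membership instead of by indices makes it insensitive to the shift that a deletion causes:
  deleting two adjacent entries removes one entry from each class and leaves the classes otherwise
  as they were.
\<close>
fun parity_class :: "bool \<Rightarrow> 'a list \<Rightarrow> 'a list" where
  "parity_class b [] = []"
| "parity_class b (x # xs) = (if b then x # parity_class False xs else parity_class True xs)"

lemma parity_class_append:
  "parity_class b (xs @ ys) = parity_class b xs @ parity_class (b = even (length xs)) ys"
  by (induction b xs rule: parity_class.induct) auto

lemma parity_class_map: "parity_class b (map f xs) = map f (parity_class b xs)"
  by (induction b xs rule: parity_class.induct) auto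

lemma set_parity_class_subset: "x \<in> set (parity_class b xs) \<Longrightarrow> x \<in> set xs"
  by (induction b xs rule: parity_class.induct) (auto split: if_splits)

lemma in_some_parity_class: "x \<in> set xs \<Longrightarrow> \<exists>b. x \<in> set (parity_class b xs)"
proof (induction xs)
  case (Cons y xs)
  show ?case
  proof (cases "x = y")
    case True
    then show ?thesis by (auto intro: exI[of _ True])
  next
    case False
    with Cons obtain b where "x \<in> set (parity_class b xs)" by auto
    then show ?thesis by (intro exI[of _ "\<not> b"]) (cases b, auto)
  qed
qed simp

lemma parity_class_rotate1:
  assumes "even (length xs)"
  shows "set (parity_class b (rotate1 xs)) = set (parity_class (\<not> b) xs)"
  using assms by (cases xs) (auto simp: parity_class_append)

definition odd_chords :: "'c endpoint list \<Rightarrow> ('c \<times> int) set" where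
  "odd_chords D = {(c, s). \<exists>b. Tail c s \<in> set (parity_class b D) \<and> Head c s \<in> set (parity_class b D)}"

definition odd_writhe :: "'c endpoint list \<Rightarrow> int" where
  "odd_writhe D = (\<Sum>(c, s)\<in>odd_chords D. s)"

lemma odd_chords_subset: "(c, s) \<in> odd_chords D \<Longrightarrow> Tail c s \<in> set D"
  by (auto simp: odd_chords_def dest: set_parity_class_subset)

lemma finite_odd_chords: "finite (odd_chords D)"
proof -
  have "odd_chords D \<subseteq> (\<lambda>e. (chord e, sign e)) ` set D"
    by (force dest: odd_chords_subset)
  then show ?thesis by (rule finite_subset) simp
qed

lemma gauss_diagram_sign: "gauss_diagram D \<Longrightarrow> e \<in> set D \<Longrightarrow> sign e = 1 \<or> sign e = -1"
  unfolding gauss_diagram_def by blast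

lemma gauss_diagram_distinct: "gauss_diagram D \<Longrightarrow> distinct D"
  unfolding gauss_diagram_def by blast

lemma gauss_diagram_Tail_iff_Head: "gauss_diagram D \<Longrightarrow> Tail c s \<in> set D \<longleftrightarrow> Head c s \<in> set D"
  unfolding gauss_diagram_def by blast

lemma gauss_diagram_sign_unique:
  "gauss_diagram D \<Longrightarrow> e \<in> set D \<Longrightarrow> f \<in> set D \<Longrightarrow> chord e = chord f \<Longrightarrow> sign e = sign f"
  unfolding gauss_diagram_def by blast

text \<open>
  Moving the base point by one place exchanges the two parity classes only if the length is even,
  which holds because the endpoints come in tail-head pairs.
\<close>
lemma gauss_diagram_even_length:
  assumes "gauss_diagram D"
  shows "even (length D)"
proof -
  let ?A = "{(c, s). Tail c s \<in> set D}"
  let ?T = "(\<lambda>(c, s). Tail c s) ` ?A" and ?H = "(\<lambda>(c, s). Head c s) ` ?A"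
  have "e \<in> set D \<longleftrightarrow> e \<in> ?T \<union> ?H" for e
    using gauss_diagram_Tail_iff_Head[OF assms] by (cases e) auto
  then have D: "set D = ?T \<union> ?H" by blast
  have "finite (?T \<union> ?H)" by (subst D[symmetric]) simp
  then have fin: "finite ?T" "finite ?H" by simp_all
  have "card ?T = card ?A" "card ?H = card ?A"
    by (auto intro!: card_image simp: inj_on_def)
  moreover have "card (?T \<union> ?H) = card ?T + card ?H"
    by (rule card_Un_disjoint[OF fin]) auto
  moreover have "card (set D) = card (?T \<union> ?H)"
    by (rule arg_cong[OF D])
  ultimately show ?thesis
    using gauss_diagram_distinct[OF assms] by (simp flip: distinct_card)
qed

section \<open>Invariance of the odd writhe under isotopy\<close>

text \<open>
  Oddness asks for both ends in the same class, whichever it is, so the exchange of the classes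
  under a change of base point is invisible.
\<close>
lemma odd_chords_rotate:
  assumes "even (length D)"
  shows "odd_chords (rotate n D) = odd_chords D"
proof (induction n)
  case (Suc n)
  have "odd_chords (rotate1 (rotate n D)) = odd_chords (rotate n D)"
    using assms by (auto simp: odd_chords_def parity_class_rotate1 ex_bool_eq)
  with Suc show ?case by simp
qed simp

lemma odd_chords_map:
  assumes "inj_on f (chord ` set D)"
  shows "odd_chords (map (map_endpoint f) D) = map_prod f id ` odd_chords D"
proof -
  have T: "Tail c s \<in> map_endpoint f ` S \<longleftrightarrow> (\<exists>d. c = f d \<and> Tail d s \<in> S)" for c s S
  proof
    assume "Tail c s \<in> map_endpoint f ` S"
    then obtain e where "e \<in> S" "Tail c s = map_endpoint f e" by blast
    then show "\<exists>d. c = f d \<and> Tail d s \<in> S" by (cases e) auto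
  qed (auto intro: rev_image_eqI)
  have H: "Head c s \<in> map_endpoint f ` S \<longleftrightarrow> (\<exists>d. c = f d \<and> Head d s \<in> S)" for c s S
  proof
    assume "Head c s \<in> map_endpoint f ` S"
    then obtain e where "e \<in> S" "Head c s = map_endpoint f e" by blast
    then show "\<exists>d. c = f d \<and> Head d s \<in> S" by (cases e) auto
  qed (auto intro: rev_image_eqI)
  have eq: "d = d'" if "f d = f d'" "Tail d s \<in> set (parity_class b D)"
     "Head d' s \<in> set (parity_class b D)" for d d' s b
    using that assms by (force dest!: set_parity_class_subset dest: inj_onD)
  have "(c, s) \<in> odd_chords (map (map_endpoint f) D) \<longleftrightarrow> (\<exists>d. c = f d \<and> (d, s) \<in> odd_chords D)" for c s
    unfolding odd_chords_def parity_class_map set_map mem_Collect_eq prod.case T H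
    by (metis eq)
  then show ?thesis by (auto simp: image_iff) force
qed

lemma odd_writhe_homeomorphic:
  assumes "homeomorphic D E"
  shows "odd_writhe D = odd_writhe E"
proof -
  obtain f n where D: "gauss_diagram D" and inj: "inj_on f (chords D)"
    and E: "E = rotate n (map (map_endpoint f) D)"
    using assms by (auto simp: homeomorphic_def)
  have "odd_chords E = map_prod f id ` odd_chords D"
    using inj gauss_diagram_even_length[OF D]
    by (simp add: E odd_chords_rotate odd_chords_map chords_def)
  moreover have "inj_on (map_prod f id) (odd_chords D)"
  proof (rule inj_onI, clarify)
    fix c s d t
    assume "(c, s) \<in> odd_chords D" "(d, t) \<in> odd_chords D"
      and eq: "map_prod f id (c, s) = map_prod f id (d, t)"
    then have "c \<in> chords D" "d \<in> chords D"
      by (auto simp: chords_def dest!: odd_chords_subset intro: rev_image_eqI)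
    with inj eq show "c = d \<and> s = t" by (auto dest: inj_onD)
  qed
  ultimately show ?thesis
    by (simp add: odd_writhe_def sum.reindex case_prod_beta)
qed

text \<open>Adjacent endpoints lie in different classes, so the chord of a first move is even.\<close>
lemma odd_chords_R1:
  assumes "gauss_diagram (arc p (Tail c s) (Head c s) @ u)"
  shows "odd_chords (arc p (Tail c s) (Head c s) @ u) = odd_chords u"
proof -
  have "Tail c s \<notin> set u" "Head c s \<notin> set u"
    using gauss_diagram_distinct[OF assms] by (auto simp: arc_def split: if_splits)
  then have "Tail c s \<notin> set (parity_class b u)" "Head c s \<notin> set (parity_class b u)" for b
    by (auto dest: set_parity_class_subset)
  then show ?thesis
    by (auto simp: odd_chords_def arc_def parity_class_append ex_bool_eq)
qed

text \<open>
  The tails of the two chords lie in different classes, and so do their heads. Hence either both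
  chords are odd and their opposite signs cancel, or both are even.
\<close>
lemma odd_writhe_R2:
  assumes D: "D = arc p (Tail a s) (Tail b (-s)) @ u @ arc q (Head a s) (Head b (-s)) @ v"
    and gauss: "gauss_diagram D"
  shows "odd_writhe D = odd_writhe (u @ v)"
proof -
  have dist: "distinct D" using gauss by (rule gauss_diagram_distinct)
  have ab: "a \<noteq> b"
  proof
    assume "a = b"
    moreover have "Tail a s \<in> set D" "Tail b (-s) \<in> set D" by (auto simp: D arc_def)
    ultimately have "s = -s" "s \<in> {1, -1}"
      using gauss unfolding gauss_diagram_def by (metis endpoint.sel)+
    then show False by auto
  qed
  have not_old: "e \<notin> set (u @ v)" if "e \<in> {Tail a s, Tail b (-s), Head a s, Head b (-s)}" for e
    using dist that by (auto simp: D arc_def split: if_splits)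
  then have new: "(a, s) \<notin> odd_chords (u @ v)" "(b, -s) \<notin> odd_chords (u @ v)"
    by (blast dest: odd_chords_subset)+
  \<comment> \<open>\<open>P\<close> and \<open>Q\<close> are the classes of the tail and the head of \<open>a\<close>; those of \<open>b\<close> are
     the opposite ones.\<close>
  define P where "P \<longleftrightarrow> p = 1"
  define Q where "Q \<longleftrightarrow> (q = 1) = even (length u)"
  let ?X = "\<lambda>i. set (parity_class i (u @ v))"
  have class_D: "e \<in> set (parity_class i D) \<longleftrightarrow> e = (if i = P then Tail a s else Tail b (-s))
      \<or> e = (if i = Q then Head a s else Head b (-s)) \<or> e \<in> ?X i" for e i
    by (cases i; cases "p = 1"; cases "q = 1"; cases "even (length u)")
       (simp_all add: D P_def Q_def arc_def parity_class_append disj_ac)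
  have fresh: "e \<notin> ?X i" if "e \<in> {Tail a s, Tail b (-s), Head a s, Head b (-s)}" for e i
    using not_old that by (meson set_parity_class_subset)
  have "x \<in> odd_chords D \<longleftrightarrow> P = Q \<and> x \<in> {(a, s), (b, -s)} \<or> x \<in> odd_chords (u @ v)" for x
  proof -
    obtain c t where x: "x = (c, t)" by (cases x)
    consider "x = (a, s)" | "x = (b, -s)" | "x \<noteq> (a, s)" "x \<noteq> (b, -s)" by blast
    then show ?thesis
    proof cases
      case 1
      then show ?thesis using ab new by (simp add: odd_chords_def class_D fresh)
    next
      case 2
      then show ?thesis using ab new
        by (cases P; cases Q) (simp_all add: odd_chords_def class_D fresh ex_bool_eq)
    next
      case 3
      then have ne: "Tail c t \<noteq> Tail a s" "Tail c t \<noteq> Tail b (-s)"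
        "Head c t \<noteq> Head a s" "Head c t \<noteq> Head b (-s)"
        by (auto simp: x)
      then have "Tail c t \<in> set (parity_class i D) \<longleftrightarrow> Tail c t \<in> ?X i"
        "Head c t \<in> set (parity_class i D) \<longleftrightarrow> Head c t \<in> ?X i" for i
        by (cases "i = P"; cases "i = Q";
            simp only: class_D if_True if_False endpoint.distinct simp_thms)+
      then have "x \<in> odd_chords D \<longleftrightarrow> x \<in> odd_chords (u @ v)"
        by (simp add: x odd_chords_def)
      with 3 show ?thesis by blast
    qed
  qed
  then have "odd_chords D = (if P = Q then {(a, s), (b, -s)} else {}) \<union> odd_chords (u @ v)"
    by (intro set_eqI) simp
  with ab new show ?thesis
    by (simp add: odd_writhe_def finite_odd_chords)
qed

text \<open>
  The common core of the two cyclic orders of strands in the third move: exchanging the entries on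
  three two-element arcs moves exactly these six entries to the other class.
\<close>
lemma parity_class_swap_arcs:
  fixes x1 x2 y1 y2 z1 z2 :: 'a
  defines "K \<equiv> {x1, x2, y1, y2, z1, z2}"
  assumes dist: "distinct (arc p x1 x2 @ u @ arc q y1 y2 @ v @ arc r z1 z2 @ w)"
    and "p \<in> {1, -1}" "q \<in> {1, -1}" "r \<in> {1, -1}"
  shows "e \<in> set (parity_class b (arc (-p) x1 x2 @ u @ arc (-q) y1 y2 @ v @ arc (-r) z1 z2 @ w)) \<longleftrightarrow>
         e \<in> set (parity_class (b = (e \<notin> K)) (arc p x1 x2 @ u @ arc q y1 y2 @ v @ arc r z1 z2 @ w))"
proof -
  have len: "length (arc s x y) = 2" for s and x y :: 'a
    by (simp add: arc_def)
  have swap: "set (parity_class b (arc (-s) x y)) = set (parity_class (\<not> b) (arc s x y))"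
    if "s \<in> {1, -1}" for b s and x y :: 'a
    using that by (auto simp: arc_def)
  show ?thesis
  proof (cases "e \<in> K")
    case True
    then have "e \<notin> set u" "e \<notin> set v" "e \<notin> set w"
      using dist by (auto simp: K_def arc_def split: if_splits)
    then have "e \<notin> set (parity_class b' u)" "e \<notin> set (parity_class b' v)"
      "e \<notin> set (parity_class b' w)" for b'
      by (auto dest: set_parity_class_subset)
    with True show ?thesis
      by (cases "even (length u)"; cases "even (length v)")
         (simp_all add: parity_class_append len swap[OF assms(3)] swap[OF assms(4)] swap[OF assms(5)])
  next
    case False
    then have "e \<notin> set (parity_class b' (arc s x1 x2))" "e \<notin> set (parity_class b' (arc s y1 y2))"
      "e \<notin> set (parity_class b' (arc s z1 z2))" for b' s
      by (auto simp: K_def arc_def dest!: set_parity_class_subset split: if_splits)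
    with False show ?thesis
      by (simp add: parity_class_append len)
  qed
qed

text \<open>
  If the six entries are the ends of three whole chords, then both ends of each of these chords
  change class and all parities survive.
\<close>
lemma odd_chords_swap_arcs:
  assumes "distinct (arc p x1 x2 @ u @ arc q y1 y2 @ v @ arc r z1 z2 @ w)"
    and "p \<in> {1, -1}" "q \<in> {1, -1}" "r \<in> {1, -1}"
    and K: "\<And>c s. Tail c s \<in> {x1, x2, y1, y2, z1, z2} \<longleftrightarrow> Head c s \<in> {x1, x2, y1, y2, z1, z2}"
  shows "odd_chords (arc (-p) x1 x2 @ u @ arc (-q) y1 y2 @ v @ arc (-r) z1 z2 @ w) =
         odd_chords (arc p x1 x2 @ u @ arc q y1 y2 @ v @ arc r z1 z2 @ w)"
proof -
  define K where "K = {x1, x2, y1, y2, z1, z2}"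
  have "Tail c s \<in> K \<longleftrightarrow> Head c s \<in> K" for c s using K by (simp add: K_def)
  then have "(\<exists>b. Tail c s \<in> set (parity_class (b = (Tail c s \<notin> K)) D)
               \<and> Head c s \<in> set (parity_class (b = (Head c s \<notin> K)) D)) \<longleftrightarrow>
             (\<exists>b. Tail c s \<in> set (parity_class b D) \<and> Head c s \<in> set (parity_class b D))" for c s D
    by (cases "Head c s \<in> K") (auto simp: ex_bool_eq)
  then show ?thesis
    unfolding odd_chords_def parity_class_swap_arcs[OF assms(1-4), folded K_def] by simp
qed

lemma reidemeister_gauss:
  assumes "reidemeister D E"
  shows "gauss_diagram D" "gauss_diagram E"
  using assms by (induction rule: reidemeister.induct) auto

text \<open>
  Negating the argument of \<open>arc\<close> exchanges the two entries only for the arguments \<open>1\<close> and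
  \<open>-1\<close>; the signs of the chords and the condition on the third move
  leave no other values.
\<close>
lemma R3_allowed_signs:
  assumes "R3_allowed oT oM oB eTM eTB eMB"
    and "eTM \<in> {1, -1}" "eTB \<in> {1, -1}" "eMB \<in> {1, -1}"
  shows "oT \<in> {1, -1} \<and> oM \<in> {1, -1} \<and> oB \<in> {1, -1}"
proof -
  obtain P where "P \<in> {1, -1}" "oM = P * eTM" "oB = P * eTB" "oT = P * eTM * eTB * eMB"
    using assms(1) unfolding R3_allowed_def by blast
  then show ?thesis using assms(2-4) by (elim insertE) auto
qed

lemma odd_writhe_reidemeister:
  assumes "reidemeister D E"
  shows "odd_writhe D = odd_writhe E"
proof -
  have distinct: "distinct D" and sign: "\<And>e. e \<in> set D \<Longrightarrow> sign e = 1 \<or> sign e = -1"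
    using reidemeister_gauss(1)[OF assms] by (simp_all add: gauss_diagram_distinct gauss_diagram_sign)
  from assms show ?thesis
  proof cases
    case (R1 p c s)
    show ?thesis
      unfolding odd_writhe_def R1(1,2)
      using odd_chords_R1[OF reidemeister_gauss(1)[OF assms, unfolded R1(1)]] by simp
  next
    case (R2 p a s b u q v)
    show ?thesis
      using odd_writhe_R2[OF R2(1)] reidemeister_gauss(1)[OF assms] unfolding R2(2) by blast
  next
    case (R3_TMB T tm eTM tb eTB M mb eMB B oT oM oB u v w)
    have "Tail tm eTM \<in> set D" "Tail tb eTB \<in> set D" "Tail mb eMB \<in> set D"
      unfolding R3_TMB(1,3-5) by (auto simp: arc_def)
    then have "eTM \<in> {1, -1}" "eTB \<in> {1, -1}" "eMB \<in> {1, -1}"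
      using sign[of "Tail tm eTM"] sign[of "Tail tb eTB"] sign[of "Tail mb eMB"] by simp_all
    then have o_signs: "oT \<in> {1, -1}" "oM \<in> {1, -1}" "oB \<in> {1, -1}"
      using R3_allowed_signs[OF R3_TMB(6)] by blast+
    have "odd_chords E = odd_chords D"
      unfolding R3_TMB(1-5)
      by (rule odd_chords_swap_arcs[OF distinct[unfolded R3_TMB(1,3-5)]]) (use o_signs in auto)
    then show ?thesis by (simp add: odd_writhe_def)
  next
    case (R3_TBM T tm eTM tb eTB M mb eMB B oT oM oB u v w)
    have "Tail tm eTM \<in> set D" "Tail tb eTB \<in> set D" "Tail mb eMB \<in> set D"
      unfolding R3_TBM(1,3-5) by (auto simp: arc_def)
    then have "eTM \<in> {1, -1}" "eTB \<in> {1, -1}" "eMB \<in> {1, -1}"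
      using sign[of "Tail tm eTM"] sign[of "Tail tb eTB"] sign[of "Tail mb eMB"] by simp_all
    then have o_signs: "oT \<in> {1, -1}" "oM \<in> {1, -1}" "oB \<in> {1, -1}"
      using R3_allowed_signs[OF R3_TBM(6)] by blast+
    have "odd_chords E = odd_chords D"
      unfolding R3_TBM(1-5)
      by (rule odd_chords_swap_arcs[OF distinct[unfolded R3_TBM(1,3-5)]]) (use o_signs in auto)
    then show ?thesis by (simp add: odd_writhe_def)
  qed
qed

lemma isotopic_invariant:
  assumes "isotopic D E"
    and "\<And>D E. homeomorphic D E \<or> reidemeister D E \<Longrightarrow> F D = F E"
  shows "F D = F E"
  using assms(1) unfolding isotopic_def
proof (induction rule: equivclp_induct)
  case (step E E')
  from step(2) have "F E = F E'"
    using assms(2)[of E E'] assms(2)[of E' E] by argo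
  with step(3) show ?case by simp
qed simp

lemma isotopic_gauss_diagram:
  assumes "isotopic D E"
  shows "gauss_diagram D \<longleftrightarrow> gauss_diagram E"
proof (rule isotopic_invariant[where F = gauss_diagram, OF assms])
  show "gauss_diagram D = gauss_diagram E" if "homeomorphic D E \<or> reidemeister D E" for D E
    using that unfolding homeomorphic_def by (metis reidemeister_gauss)
qed

lemma isotopic_odd_writhe:
  assumes "isotopic D E"
  shows "odd_writhe D = odd_writhe E"
proof (rule isotopic_invariant[where F = odd_writhe, OF assms])
  show "odd_writhe D = odd_writhe E" if "homeomorphic D E \<or> reidemeister D E" for D E
    using that odd_writhe_homeomorphic odd_writhe_reidemeister by blast
qed

section \<open>Flip moves and the odd writhe\<close>

lemma flip_endpoint_involution: "flip_endpoint c (flip_endpoint c e) = e"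
  by (cases e) auto

lemma in_flip_image: "e \<in> flip_endpoint c ` S \<longleftrightarrow> flip_endpoint c e \<in> S"
proof
  assume "flip_endpoint c e \<in> S"
  then show "e \<in> flip_endpoint c ` S"
    by (rule rev_image_eqI) (simp add: flip_endpoint_involution)
qed (auto simp: flip_endpoint_involution)

lemma inj_flip_endpoint: "inj (flip_endpoint c)"
  by (rule inj_on_inverseI) (rule flip_endpoint_involution)

lemma gauss_diagram_flip:
  assumes "gauss_diagram D"
  shows "gauss_diagram (flip c D)"
proof -
  have sel: "chord (flip_endpoint c e) = chord e"
    "sign (flip_endpoint c e) = (if chord e = c then - sign e else sign e)" for e
    by (cases e; simp)+
  let ?F = "flip c D"
  show ?thesis
    unfolding gauss_diagram_def
  proof (intro conjI allI ballI impI)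
    show "distinct ?F"
      using gauss_diagram_distinct[OF assms] inj_on_subset[OF inj_flip_endpoint]
      by (simp add: flip_def distinct_map)
    show "Tail d s \<in> set ?F \<longleftrightarrow> Head d s \<in> set ?F" for d s
      using gauss_diagram_Tail_iff_Head[OF assms] by (simp add: flip_def in_flip_image)
    show "sign e \<in> {1, -1}" if "e \<in> set ?F" for e
      using that by (auto simp: flip_def sel dest!: gauss_diagram_sign[OF assms] split: if_splits)
    show "sign e = sign f" if e: "e \<in> set ?F" and f: "f \<in> set ?F" and ef: "chord e = chord f" for e f
    proof -
      obtain e' f' where "e = flip_endpoint c e'" "f = flip_endpoint c f'"
        and "e' \<in> set D" "f' \<in> set D"
        using e f by (auto simp: flip_def)
      then show ?thesis
        using ef gauss_diagram_sign_unique[OF assms, of e' f'] by (simp add: sel)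
    qed
  qed
qed

lemma odd_chords_flip:
  "odd_chords (flip c D) = (\<lambda>(d, s). (d, if d = c then -s else s)) ` odd_chords D"
proof -
  define h :: "nat \<times> int \<Rightarrow> nat \<times> int" where "h = (\<lambda>(d, s). (d, if d = c then -s else s))"
  have h: "h (h x) = x" for x by (cases x) (simp add: h_def)
  have eq: "x \<in> odd_chords (flip c D) \<longleftrightarrow> h x \<in> odd_chords D" for x
    unfolding odd_chords_def flip_def parity_class_map set_map
    by (cases x) (simp add: h_def in_flip_image conj_commute)
  have image: "h x \<in> odd_chords D \<longleftrightarrow> x \<in> h ` odd_chords D" for x
  proof
    assume "h x \<in> odd_chords D"
    then show "x \<in> h ` odd_chords D" by (rule rev_image_eqI) (rule h[symmetric])
  qed (auto simp: h)
  have "odd_chords (flip c D) = h ` odd_chords D"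
    by (rule set_eqI) (rule trans[OF eq image])
  then show ?thesis by (simp only: h_def)
qed

text \<open>At most one odd chord has its sign \<open>s\<close> replaced by \<open>-s\<close>, and \<open>s\<close> is \<open>1\<close> or \<open>-1\<close>.\<close>
lemma odd_writhe_flip:
  assumes "gauss_diagram D"
  shows "\<bar>odd_writhe D - odd_writhe (flip c D)\<bar> \<le> 2"
proof -
  define Q where "Q = {x \<in> odd_chords D. fst x = c}"
  have inj: "inj_on (\<lambda>(d, s). (d, if d = c then -s else s)) A" for A :: "(nat \<times> int) set"
    by (rule inj_onI) (auto split: if_splits)
  have "odd_writhe (flip c D) = (\<Sum>x\<in>odd_chords D. if fst x = c then - snd x else snd x)"
    unfolding odd_writhe_def odd_chords_flip sum.reindex[OF inj]
    by (rule sum.cong) auto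
  moreover have "odd_writhe D = (\<Sum>x\<in>odd_chords D. snd x)"
    unfolding odd_writhe_def by (rule sum.cong) auto
  ultimately have "odd_writhe D - odd_writhe (flip c D)
      = (\<Sum>x\<in>odd_chords D. snd x - (if fst x = c then - snd x else snd x))"
    by (simp only: sum_subtractf)
  also have "\<dots> = (\<Sum>x\<in>Q. 2 * snd x)"
    unfolding Q_def by (rule sum.mono_neutral_cong_right) (auto simp: finite_odd_chords split: if_splits)
  finally have diff: "odd_writhe D - odd_writhe (flip c D) = (\<Sum>x\<in>Q. 2 * snd x)" .
  show ?thesis
  proof (cases "Q = {}")
    case True
    then show ?thesis using diff by simp
  next
    case False
    then obtain s where s: "(c, s) \<in> odd_chords D" by (auto simp: Q_def)
    then have tail: "Tail c s \<in> set D" by (rule odd_chords_subset)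
    then have "s = 1 \<or> s = -1" using gauss_diagram_sign[OF assms, of "Tail c s"] by simp
    moreover have uniq: "t = s" if "(c, t) \<in> odd_chords D" for t
      using gauss_diagram_sign_unique[OF assms tail odd_chords_subset[OF that]] by simp
    have "Q = {(c, s)}"
    proof (intro equalityI subsetI)
      fix x assume "x \<in> Q"
      then have "x = (c, snd x)" "x \<in> odd_chords D" by (auto simp: Q_def)
      then show "x \<in> {(c, s)}" using uniq[of "snd x"] by auto
    qed (use s in \<open>simp add: Q_def\<close>)
    ultimately show ?thesis using diff by auto
  qed
qed

lemma homotopy_odd_writhe:
  assumes "homotopy n D E" and "gauss_diagram D"
  shows "gauss_diagram E \<and> \<bar>odd_writhe D - odd_writhe E\<bar> \<le> 2 * int n"
  using assms
proof induction
  case (isotopy D E)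
  then show ?case by (auto dest: isotopic_gauss_diagram isotopic_odd_writhe)
next
  case (flip n D E c F)
  then show ?case
    using odd_writhe_flip[of E c] gauss_diagram_flip[of E c]
      isotopic_gauss_diagram[of "flip c E" F] isotopic_odd_writhe[of "flip c E" F]
    by auto
qed

section \<open>Diagrams without bridges\<close>

text \<open>
  An arc stops at the first head, so it contains only tails; it has one exactly when it is not empty,
  that is, when the very next endpoint is a tail.
\<close>
lemma arc_after_has_tail:
  assumes "D \<noteq> []"
  shows "(\<exists>e\<in>set (arc_after D i). is_tail e) \<longleftrightarrow> is_tail (D ! (Suc i mod length D))"
proof -
  have tail: "is_tail e \<longleftrightarrow> \<not> is_head e" for e :: "nat endpoint" by (cases e) auto
  obtain xs where "rotate (Suc i) D = D ! (Suc i mod length D) # xs"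
    using assms by (metis hd_rotate_conv_nth list.collapse rotate_is_Nil_conv)
  then have "arc_after D i = takeWhile (\<lambda>e. \<not> is_head e) (D ! (Suc i mod length D) # xs)"
    by (simp only: arc_after_def)
  then show ?thesis
    by (cases "is_head (D ! (Suc i mod length D))") (auto simp: tail dest: set_takeWhileD)
qed

text \<open>
  Without bridges every head is followed by a head, so all endpoints are heads; but a diagram with
  a chord also has a tail.
\<close>
lemma bridges_eq_0:
  assumes "gauss_diagram D" and "bridges D = 0"
  shows "D = []"
proof (rule ccontr)
  let ?n = "length D"
  assume "D \<noteq> []"
  then have n: "?n > 0" by simp
  obtain i j where i: "i < ?n" "is_head (D ! i)" and j: "j < ?n" "is_tail (D ! j)"
  proof -
    obtain c s where "Head c s \<in> set D" "Tail c s \<in> set D"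
      using \<open>D \<noteq> []\<close> gauss_diagram_Tail_iff_Head[OF assms(1)]
      by (cases D; cases "hd D") fastforce+
    then show thesis by (auto simp: in_set_conv_nth intro: that)
  qed
  have next_head: "is_head (D ! (Suc k mod ?n))" if "k < ?n" "is_head (D ! k)" for k
  proof (rule ccontr)
    assume "\<not> is_head (D ! (Suc k mod ?n))"
    then have "\<exists>e\<in>set (arc_after D k). is_tail e"
      unfolding arc_after_has_tail[OF \<open>D \<noteq> []\<close>] by (cases "D ! (Suc k mod ?n)") auto
    with that have "k \<in> {i. i < length D \<and> is_head (D ! i) \<and> (\<exists>e\<in>set (arc_after D i). is_tail e)}"
      by blast
    then show False using assms(2) by (auto simp: bridges_def)
  qed
  have "is_head (D ! ((i + k) mod ?n))" for k
  proof (induction k)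
    case (Suc k)
    then show ?case using next_head[of "(i + k) mod ?n"] n by (simp add: mod_Suc_eq)
  qed (use i in simp)
  from this[of "j + ?n - i"] show False using i j by (cases "D ! j") auto
qed

section \<open>Parallel diagrams\<close>

text \<open>
  All tails, then all heads in the same order, for a list of chords with their signs.
  Any two of its chords cross each other.
\<close>
definition parallel_diagram :: "(nat \<times> int) list \<Rightarrow> gauss_word" where
  "parallel_diagram cs = map (\<lambda>(c, s). Tail c s) cs @ map (\<lambda>(c, s). Head c s) cs"

lemma in_parallel_diagram: "e \<in> set (parallel_diagram cs) \<longleftrightarrow> (chord e, sign e) \<in> set cs"
  by (cases e) (force simp: parallel_diagram_def)+

lemma gauss_diagram_parallel:
  assumes "distinct (map fst cs)" and "\<And>c s. (c, s) \<in> set cs \<Longrightarrow> s \<in> {1, -1}"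
  shows "gauss_diagram (parallel_diagram cs)"
  unfolding gauss_diagram_def
proof (intro conjI allI ballI impI)
  have "distinct cs" using assms(1) by (simp add: distinct_map)
  then show "distinct (parallel_diagram cs)"
    by (auto simp: parallel_diagram_def distinct_map inj_on_def)
  show "sign e \<in> {1, -1}" if "e \<in> set (parallel_diagram cs)" for e
    using that assms(2)[of "chord e" "sign e"] by (simp only: in_parallel_diagram)
  show "sign e = sign f"
    if "e \<in> set (parallel_diagram cs)" "f \<in> set (parallel_diagram cs)" "chord e = chord f" for e f
    using that eq_key_imp_eq_value[OF assms(1), of "chord e" "sign e" "sign f"]
    by (simp add: in_parallel_diagram)
qed (simp add: in_parallel_diagram)

text \<open>
  The tail and the head of a chord are \<open>length cs\<close> places apart, which is an even distance, so every
  chord is odd.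
\<close>
lemma odd_chords_parallel:
  assumes "even (length cs)"
  shows "odd_chords (parallel_diagram cs) = set cs"
proof -
  have "odd_chords (parallel_diagram cs) = {x. \<exists>b. x \<in> set (parity_class b cs)}"
  proof -
    have "parity_class b (parallel_diagram cs) = parallel_diagram (parity_class b cs)" for b
      using assms by (simp add: parallel_diagram_def parity_class_append parity_class_map)
    then show ?thesis by (auto simp: odd_chords_def in_parallel_diagram)
  qed
  also have "\<dots> = set cs"
    using in_some_parity_class set_parity_class_subset by fast
  finally show ?thesis .
qed

text \<open>Only the last head is followed by a tail, namely by the first one.\<close>
lemma bridges_parallel:
  assumes "cs \<noteq> []"
  shows "bridges (parallel_diagram cs) = 1"
proof -
  let ?D = "parallel_diagram cs" and ?n = "length cs"
  have len: "length ?D = 2 * ?n" by (simp add: parallel_diagram_def)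
  have head: "is_head (?D ! i) \<longleftrightarrow> ?n \<le> i" and tail: "is_tail (?D ! i) \<longleftrightarrow> i < ?n"
    if "i < 2 * ?n" for i
    using that by (auto simp: parallel_diagram_def nth_append case_prod_beta)
  have arc: "(\<exists>e\<in>set (arc_after ?D i). is_tail e) \<longleftrightarrow> Suc i = 2 * ?n"
    if i: "?n \<le> i" "i < 2 * ?n" for i
  proof -
    have "?D \<noteq> []" using assms by (simp add: parallel_diagram_def)
    then show ?thesis
      using i assms tail[of 0] tail[of "Suc i"]
      by (cases "Suc i = 2 * ?n") (simp_all add: arc_after_has_tail len)
  qed
  have "i < length ?D \<and> is_head (?D ! i) \<and> (\<exists>e\<in>set (arc_after ?D i). is_tail e)
      \<longleftrightarrow> ?n \<le> i \<and> Suc i = 2 * ?n" for i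
    using head[of i] arc[of i] by (cases "i < 2 * ?n"; cases "?n \<le> i") (simp_all add: len)
  also have "?n \<le> i \<and> Suc i = 2 * ?n \<longleftrightarrow> i = 2 * ?n - 1" for i
    using assms by (cases cs) auto
  finally show ?thesis by (simp add: bridges_def)
qed

lemma gauss_diagram_append_commute: "gauss_diagram (u @ v) \<Longrightarrow> gauss_diagram (v @ u)"
proof -
  have eq: "set (v @ u) = set (u @ v)" "distinct (v @ u) = distinct (u @ v)" by auto
  show "gauss_diagram (u @ v) \<Longrightarrow> gauss_diagram (v @ u)" unfolding gauss_diagram_def eq by blast
qed

lemma isotopic_append_commute:
  assumes "gauss_diagram (u @ v)"
  shows "isotopic (u @ v) (v @ u)"
proof -
  have "map_endpoint (\<lambda>c. c :: nat) = id" by (rule ext) (simp add: endpoint.map_ident)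
  then have "v @ u = rotate (length u) (map (map_endpoint (\<lambda>c. c)) (u @ v))"
    by (simp add: rotate_append)
  moreover have "inj_on (\<lambda>c. c) (chords (u @ v))" by simp
  ultimately have "homeomorphic (u @ v) (v @ u)"
    using assms gauss_diagram_append_commute[OF assms] unfolding homeomorphic_def by blast
  then show ?thesis unfolding isotopic_def by (blast intro: r_into_equivclp)
qed

lemma isotopic_trans: "isotopic D E \<Longrightarrow> isotopic E F \<Longrightarrow> isotopic D F"
  unfolding isotopic_def by (rule equivclp_trans)

text \<open>
  Neighbours in the list have adjacent tails and adjacent heads, so with opposite signs they cancel
  in a second move. The base point has to be moved to the arc of the two tails and back.
\<close>
lemma isotopic_parallel_cancel:
  assumes "gauss_diagram (parallel_diagram (ps @ [(a, s), (b, -s)] @ qs))"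
    and "gauss_diagram (parallel_diagram (ps @ qs))"
  shows "isotopic (parallel_diagram (ps @ [(a, s), (b, -s)] @ qs)) (parallel_diagram (ps @ qs))"
proof -
  define T :: "(nat \<times> int) list \<Rightarrow> gauss_word" where "T = map (\<lambda>(c, s). Tail c s)"
  define H :: "(nat \<times> int) list \<Rightarrow> gauss_word" where "H = map (\<lambda>(c, s). Head c s)"
  let ?D = "arc 1 (Tail a s) (Tail b (-s)) @ (T qs @ H ps) @ arc 1 (Head a s) (Head b (-s)) @ (H qs @ T ps)"
  have old: "parallel_diagram (ps @ [(a, s), (b, -s)] @ qs) = T ps @ arc 1 (Tail a s) (Tail b (-s)) @
      T qs @ H ps @ arc 1 (Head a s) (Head b (-s)) @ H qs"
    by (simp add: parallel_diagram_def T_def H_def arc_def)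
  have new: "parallel_diagram (ps @ qs) = T ps @ T qs @ H ps @ H qs"
    by (simp add: parallel_diagram_def T_def H_def)
  have D: "gauss_diagram ?D"
    using gauss_diagram_append_commute[OF assms(1)[unfolded old]] by simp
  have E: "gauss_diagram ((T qs @ H ps) @ (H qs @ T ps))"
    using gauss_diagram_append_commute[OF assms(2)[unfolded new]] by simp
  have "isotopic (parallel_diagram (ps @ [(a, s), (b, -s)] @ qs)) ?D"
    unfolding old using isotopic_append_commute[OF assms(1)[unfolded old]] by simp
  moreover have "isotopic ?D ((T qs @ H ps) @ (H qs @ T ps))"
    unfolding isotopic_def by (rule r_into_equivclp) (rule disjI2, rule R2[OF D E])
  moreover have "isotopic ((T qs @ H ps) @ (H qs @ T ps)) (parallel_diagram (ps @ qs))"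
    using isotopic_append_commute[of "T qs @ H ps @ H qs" "T ps"] E by (simp add: new)
  ultimately show ?thesis by (blast intro: isotopic_trans)
qed

text \<open>
  The last positive and the first negative chord are neighbours and cancel, which leaves a list of
  the same shape.
\<close>
lemma isotopic_nested_parallel_Nil:
  assumes "length xs = length ys" and "distinct (xs @ ys)"
  shows "isotopic (parallel_diagram (map (\<lambda>c. (c, 1)) xs @ map (\<lambda>c. (c, -1)) ys)) []"
  using assms
proof (induction xs arbitrary: ys rule: rev_induct)
  case Nil
  then show ?case by (simp add: parallel_diagram_def isotopic_def)
next
  case (snoc a xs)
  then obtain b zs where ys: "ys = b # zs" by (cases ys) auto
  let ?ps = "map (\<lambda>c. (c, 1 :: int)) xs" and ?qs = "map (\<lambda>c. (c, -1 :: int)) zs"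
  have "isotopic (parallel_diagram (?ps @ [(a, 1), (b, -1)] @ ?qs)) (parallel_diagram (?ps @ ?qs))"
    using snoc.prems ys
    by (intro isotopic_parallel_cancel gauss_diagram_parallel) (auto simp: comp_def)
  moreover have "isotopic (parallel_diagram (?ps @ ?qs)) []"
    using snoc.prems ys by (intro snoc.IH) auto
  ultimately show ?case by (auto simp: ys intro: isotopic_trans)
qed

section \<open>Unknotting a positive parallel diagram\<close>

lemma homotopy_isotopic:
  assumes "homotopy n D E" and "isotopic E F"
  shows "homotopy n D F"
  using assms by cases (auto intro: homotopy.intros isotopic_trans)

text \<open>
  The simultaneous flip of all chords with labels below \<open>k\<close>; each label flips its own chord, so
  this is the composite of the flips of \<open>0, \<dots>, k - 1\<close>.
\<close>
definition flip_below :: "nat \<Rightarrow> gauss_word \<Rightarrow> gauss_word" where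
  "flip_below k D = map (\<lambda>e. if chord e < k then flip_endpoint (chord e) e else e) D"

lemma flip_flip_below: "flip k (flip_below k D) = flip_below (Suc k) D"
proof -
  have "flip_endpoint k (if chord e < k then flip_endpoint (chord e) e else e) =
        (if chord e < Suc k then flip_endpoint (chord e) e else e)" for e
    by (cases e) auto
  then show ?thesis by (simp add: flip_def flip_below_def)
qed

lemma chords_flip_below: "chords (flip_below k D) = chords D"
proof -
  have "chord (flip_endpoint c e) = chord e" for c e by (cases e) auto
  then have "map chord (flip_below k D) = map chord D" by (simp add: flip_below_def)
  then show ?thesis unfolding chords_def set_map[symmetric] by (rule arg_cong)
qed

lemma homotopy_flip_below:
  assumes "{..<k} \<subseteq> chords D"
  shows "homotopy k D (flip_below k D)"
  using assms
proof (induction k)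
  case 0
  then show ?case by (auto simp: flip_below_def isotopic_def intro: homotopy.isotopy)
next
  case (Suc k)
  then have "homotopy k D (flip_below k D)" "k \<in> chords (flip_below k D)"
    by (simp_all add: chords_flip_below lessThan_Suc)
  then show ?case
    by (rule homotopy.flip) (simp add: flip_flip_below isotopic_def)
qed

definition example :: "nat \<Rightarrow> gauss_word" where
  "example i = parallel_diagram (map (\<lambda>c. (c, 1)) [0..<2 * i])"

lemma gauss_diagram_example: "gauss_diagram (example i)"
  unfolding example_def by (rule gauss_diagram_parallel) (auto simp: comp_def)

lemma odd_writhe_example: "odd_writhe (example i) = 2 * int i"
proof -
  have "odd_chords (example i) = (\<lambda>c. (c, 1)) ` {..<2 * i}"
    by (simp add: example_def odd_chords_parallel atLeast0LessThan)
  then show ?thesis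
    by (simp add: odd_writhe_def sum.reindex inj_on_def)
qed

text \<open>
  Flipping turns the first half of the tails into heads and the first half of the heads into tails.
  Read from the tails of the second half on, the word is again a parallel diagram: the positive
  chords of the second half come first, and the flipped, negative ones follow.
\<close>
lemma homotopy_example_Nil: "homotopy i (example i) []"
proof -
  define A where "A = [0..<i]"
  define B where "B = [i..<2 * i]"
  have AB: "[0..<2 * i] = A @ B"
    using upt_add_eq_append[of 0 i i] by (simp add: A_def B_def mult_2)
  have A: "c < i" if "c \<in> set A" for c using that by (simp add: A_def)
  have B: "\<not> c < i" if "c \<in> set B" for c using that by (simp add: B_def)
  have "distinct (B @ A)" "length B = length A" by (auto simp: A_def B_def)
  let ?u = "map (\<lambda>c. Head c (-1)) A"
  let ?v = "map (\<lambda>c. Tail c 1) B @ map (\<lambda>c. Tail c (-1)) A @ map (\<lambda>c. Head c 1) B"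
  let ?flipped = "parallel_diagram (map (\<lambda>c. (c, 1)) B @ map (\<lambda>c. (c, -1)) A)"
  have flipped: "flip_below i (example i) = ?u @ ?v"
    by (simp add: example_def AB flip_below_def parallel_diagram_def comp_def A B cong: map_cong)
  have rotated: "?v @ ?u = ?flipped"
    by (simp add: parallel_diagram_def comp_def)
  have "gauss_diagram ?flipped"
    using \<open>distinct (B @ A)\<close> by (intro gauss_diagram_parallel) (auto simp: comp_def)
  then have "isotopic (?u @ ?v) ?flipped"
    using isotopic_append_commute[of ?u ?v] gauss_diagram_append_commute[of ?v ?u]
    by (simp only: rotated)
  moreover have "isotopic ?flipped []"
    using \<open>distinct (B @ A)\<close> \<open>length B = length A\<close> by (rule isotopic_nested_parallel_Nil[rotated])
  ultimately have "isotopic (flip_below i (example i)) []"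
    unfolding flipped by (rule isotopic_trans)
  moreover have "homotopy i (example i) (flip_below i (example i))"
  proof (rule homotopy_flip_below, rule subsetI)
    fix c assume "c \<in> {..<i}"
    then have "Tail c 1 \<in> set (example i)" by (simp add: example_def in_parallel_diagram image_iff)
    then show "c \<in> chords (example i)" unfolding chords_def by (rule rev_image_eqI) simp
  qed
  ultimately show ?thesis by (blast intro: homotopy_isotopic)
qed

theorem theorem2p5:
  fixes i :: nat
  assumes "i > 0"
  shows "\<exists>K\<in>virtual_knots. homotopic K unknot \<and> vb K = 1 \<and> vu K = i"
proof (intro bexI conjI)
  let ?K = "isotopy_rel `` {example i}"
  have K: "D \<in> ?K \<longleftrightarrow> gauss_diagram D \<and> isotopic (example i) D" for D
    using gauss_diagram_example by (simp add: isotopy_rel_def)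
  have U: "E \<in> unknot \<longleftrightarrow> gauss_diagram E \<and> isotopic [] E" for E
    using gauss_diagram_Nil by (simp add: unknot_def isotopy_rel_def)
  have example_K: "example i \<in> ?K"
    unfolding K using gauss_diagram_example by (simp add: isotopic_def)
  have Nil_U: "[] \<in> unknot"
    unfolding U using gauss_diagram_Nil by (simp add: isotopic_def)
  have writhe_Nil: "odd_writhe ([] :: gauss_word) = 0"
    by (simp add: odd_writhe_def odd_chords_def)
  have writhe_K: "odd_writhe D = 2 * int i" if "D \<in> ?K" for D
    using that isotopic_odd_writhe[of "example i" D] odd_writhe_example[of i] unfolding K by simp
  have writhe_U: "odd_writhe E = 0" if "E \<in> unknot" for E
    using that isotopic_odd_writhe[of "[]" E] writhe_Nil unfolding U by simp
  show "?K \<in> virtual_knots"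
    unfolding virtual_knots_def by (rule quotientI) (simp add: gauss_diagram_example)
  show "homotopic ?K unknot"
    unfolding homotopic_def using example_K Nil_U homotopy_example_Nil by blast
  show "vb ?K = 1"
    unfolding vb_def
  proof (rule Least_equality)
    have "bridges (example i) = 1"
      unfolding example_def by (rule bridges_parallel) (use assms in simp)
    with example_K show "\<exists>D\<in>?K. bridges D = 1" by blast
  next
    fix n assume "\<exists>D\<in>?K. bridges D = n"
    then obtain D where D: "D \<in> ?K" "bridges D = n" by blast
    have "n \<noteq> 0"
    proof
      assume "n = 0"
      then have "D = []" using D bridges_eq_0 unfolding K by blast
      then show False using writhe_K[OF D(1)] writhe_Nil assms by simp
    qed
    then show "1 \<le> n" by simp
  qed
  show "vu ?K = i"
    unfolding vu_def
  proof (rule Least_equality)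
    show "\<exists>D\<in>?K. \<exists>E\<in>unknot. homotopy i D E"
      using example_K Nil_U homotopy_example_Nil by blast
  next
    fix n assume "\<exists>D\<in>?K. \<exists>E\<in>unknot. homotopy n D E"
    then obtain D E where D: "D \<in> ?K" and E: "E \<in> unknot" and h: "homotopy n D E" by blast
    have "gauss_diagram D" using D unfolding K by blast
    then have "\<bar>odd_writhe D - odd_writhe E\<bar> \<le> 2 * int n"
      using homotopy_odd_writhe[OF h] by blast
    then show "i \<le> n" unfolding writhe_K[OF D] writhe_U[OF E] by simp
  qed
qed

end
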